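(* Let $\alpha\in(1,2)$, $p=\alpha-1$, and fix $T>0$. Consider the four families of pairs of processes on $[0,T]$: (i) $X_t=x_0+W_t+Z_t$, $\tilde X_t=\tilde x_0+W_t+Z_t$ with $x_0,\tilde x_0\in\mathbb{R}$, and error variable $E=|x_0-\tilde x_0|$; (ii) $X_t=bt$, $\tilde X_t=\tilde bt$ with $b,\tilde b\in\mathbb{R}$, and error variable $E=B=T|b-\tilde b|$; (iii) $X_t=aW_t$, $\tilde X_t=\tilde aW_t$ with $a,\tilde a\in\mathbb{R}$, and error variable $E=A=T^{1/2}|a-\tilde a|$; (iv) $X_t=\sigma Z_t$, $\tilde X_t=\tilde\sigma Z_t$ with $\sigma,\tilde\sigma\in\mathbb{R}$, and error variable $E=S=T^{1/\alpha}|\sigma-\tilde\sigma|$. In each of these four families, there do not exist constants $C>0$, $q>p$ and $E_0>0$ such that $$\sup_{0\le t\le T}\mathbb{E}|X_t-\tilde X_t|^p\le C E^q$$ for all $0<E<E_0$ (that is, for all members of the family whose error variable satisfies $0<E<E_0$). In particular, in the Lipschitz case, the exponent $\alpha-1$ is optimal separately for the initial value, drift, Brownian diffusion and stable jump coefficient errors within this constant-coefficient subclass.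
   Context: $W$ is a one-dimensional standard Brownian motion and $Z$ is a one-dimensional symmetric $\alpha$-stable process independent of $W$, with Lévy measure $c_\alpha|z|^{-1-\alpha}dz$ on $\mathbb{R}\setminus\{0\}$, $c_\alpha>0$ a fixed constant, and no drift or Gaussian part. The quantities $B,A,S$ are the distances $B=\int_0^T\mathbb{E}|b(s,X_s)-\tilde b(s,X_s)|ds$, $A^2=\int_0^T\mathbb{E}|a(s,X_s)-\tilde a(s,X_s)|^2ds$, $S^\alpha=\int_0^T\mathbb{E}|\sigma(s,X_s)-\tilde\sigma(s,X_s)|^\alpha ds$ between drift, Brownian and stable coefficients, which for the constant coefficients above take the indicated values. *)

theory Defs
  imports "HOL-Probability.Probability"
begin

text \<open>
  Processes are functions \<open>X :: real \<Rightarrow> 'w \<Rightarrow> real\<close>, of which only the times in the interval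
  \<open>{0..T}\<close> are ever used.
\<close>

definition indep_increments :: "'w measure \<Rightarrow> real \<Rightarrow> (real \<Rightarrow> 'w \<Rightarrow> real) \<Rightarrow> bool" where
  "indep_increments M T X \<longleftrightarrow>
     (\<forall>n. \<forall>t :: nat \<Rightarrow> real. mono_on {..n} t \<and> t ` {..n} \<subseteq> {0..T} \<longrightarrow>
        prob_space.indep_vars M (\<lambda>_. borel) (\<lambda>i \<omega>. X (t (Suc i)) \<omega> - X (t i) \<omega>) {..<n})"

definition standard_brownian_motion ::
    "'w measure \<Rightarrow> real \<Rightarrow> (real \<Rightarrow> 'w \<Rightarrow> real) \<Rightarrow> bool" where
  "standard_brownian_motion M T W \<longleftrightarrow>
     (\<forall>t\<in>{0..T}. W t \<in> borel_measurable M) \<and>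
     (AE \<omega> in M. W 0 \<omega> = 0) \<and>
     indep_increments M T W \<and>
     (\<forall>s t. 0 \<le> s \<and> s < t \<and> t \<le> T \<longrightarrow>
        distributed M lborel (\<lambda>\<omega>. W t \<omega> - W s \<omega>) (normal_density 0 (sqrt (t - s)))) \<and>
     (AE \<omega> in M. continuous_on {0..T} (\<lambda>t. W t \<omega>))"

definition cadlag_on :: "real \<Rightarrow> (real \<Rightarrow> real) \<Rightarrow> bool" where
  "cadlag_on T f \<longleftrightarrow>
     (\<forall>t\<in>{0..<T}. (f \<longlongrightarrow> f t) (at_right t)) \<and>
     (\<forall>t\<in>{0<..T}. \<exists>l. (f \<longlongrightarrow> l) (at_left t))"

definition levy_measure :: "real measure \<Rightarrow> bool" where
  "levy_measure \<nu> \<longleftrightarrow>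
     sets \<nu> = sets borel \<and> emeasure \<nu> {0} = 0 \<and> (\<integral>\<^sup>+z. ennreal (min 1 (z\<^sup>2)) \<partial>\<nu>) < \<infinity>"

text \<open>
  The Levy-Khintchine exponent of the triplet \<open>(d, v, \<nu>)\<close> (drift, Gaussian variance, Levy
  measure), with respect to the truncation function \<open>z \<mapsto> z * indicator {-1..1} z\<close>.
  For a symmetric \<open>\<nu>\<close> the compensator integrates to zero, so that having no drift does not
  depend on the choice of a symmetric truncation.
\<close>

definition levy_exponent :: "real \<Rightarrow> real \<Rightarrow> real measure \<Rightarrow> real \<Rightarrow> complex" where
  "levy_exponent d v \<nu> u =
     \<i> * of_real (d * u) - of_real (v * u\<^sup>2 / 2) +
     (CLINT z|\<nu>. iexp (u * z) - 1 - \<i> * of_real (u * z * indicator {-1..1} z))"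

definition levy_process ::
    "'w measure \<Rightarrow> real \<Rightarrow> real \<Rightarrow> real \<Rightarrow> real measure \<Rightarrow> (real \<Rightarrow> 'w \<Rightarrow> real) \<Rightarrow> bool" where
  "levy_process M T d v \<nu> X \<longleftrightarrow>
     levy_measure \<nu> \<and> v \<ge> 0 \<and>
     (\<forall>t\<in>{0..T}. X t \<in> borel_measurable M) \<and>
     (AE \<omega> in M. X 0 \<omega> = 0) \<and>
     indep_increments M T X \<and>
     (\<forall>s t. 0 \<le> s \<and> s \<le> t \<and> t \<le> T \<longrightarrow>
        distr M borel (\<lambda>\<omega>. X t \<omega> - X s \<omega>) = distr M borel (X (t - s))) \<and>
     (\<forall>t\<in>{0..T}. \<forall>u. char (distr M borel (X t)) u = exp (of_real t * levy_exponent d v \<nu> u)) \<and>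
     (AE \<omega> in M. cadlag_on T (\<lambda>t. X t \<omega>))"

definition stable_levy_measure :: "real \<Rightarrow> real \<Rightarrow> real measure" where
  "stable_levy_measure \<alpha> c = density lborel (\<lambda>z. ennreal (c * \<bar>z\<bar> powr (- 1 - \<alpha>)))"

definition symmetric_stable_process ::
    "'w measure \<Rightarrow> real \<Rightarrow> real \<Rightarrow> real \<Rightarrow> (real \<Rightarrow> 'w \<Rightarrow> real) \<Rightarrow> bool" where
  "symmetric_stable_process M T \<alpha> c Z \<longleftrightarrow> levy_process M T 0 0 (stable_levy_measure \<alpha> c) Z"

definition indep_processes ::
    "'w measure \<Rightarrow> real \<Rightarrow> (real \<Rightarrow> 'w \<Rightarrow> real) \<Rightarrow> (real \<Rightarrow> 'w \<Rightarrow> real) \<Rightarrow> bool" where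
  "indep_processes M T X Y \<longleftrightarrow>
     prob_space.indep_var M
       (PiM {0..T} (\<lambda>_. borel)) (\<lambda>\<omega>. \<lambda>t\<in>{0..T}. X t \<omega>)
       (PiM {0..T} (\<lambda>_. borel)) (\<lambda>\<omega>. \<lambda>t\<in>{0..T}. Y t \<omega>)"

text \<open>
  The distances between the drift, Brownian and stable coefficients along \<open>X\<close>: the numbers
  \<open>B\<close>, \<open>A\<close> and \<open>S\<close>.
\<close>

definition drift_dist ::
    "'w measure \<Rightarrow> real \<Rightarrow> (real \<Rightarrow> real \<Rightarrow> real) \<Rightarrow> (real \<Rightarrow> real \<Rightarrow> real) \<Rightarrow>
     (real \<Rightarrow> 'w \<Rightarrow> real) \<Rightarrow> real" where
  "drift_dist M T b b' X =
     (LINT s:{0..T}|lborel. (LINT \<omega>|M. \<bar>b s (X s \<omega>) - b' s (X s \<omega>)\<bar>))"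

definition brownian_dist ::
    "'w measure \<Rightarrow> real \<Rightarrow> (real \<Rightarrow> real \<Rightarrow> real) \<Rightarrow> (real \<Rightarrow> real \<Rightarrow> real) \<Rightarrow>
     (real \<Rightarrow> 'w \<Rightarrow> real) \<Rightarrow> real" where
  "brownian_dist M T a a' X =
     sqrt (LINT s:{0..T}|lborel. (LINT \<omega>|M. \<bar>a s (X s \<omega>) - a' s (X s \<omega>)\<bar>\<^sup>2))"

definition stable_dist ::
    "'w measure \<Rightarrow> real \<Rightarrow> real \<Rightarrow> (real \<Rightarrow> real \<Rightarrow> real) \<Rightarrow> (real \<Rightarrow> real \<Rightarrow> real) \<Rightarrow>
     (real \<Rightarrow> 'w \<Rightarrow> real) \<Rightarrow> real" where
  "stable_dist M T \<alpha> \<sigma> \<sigma>' X =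
     (LINT s:{0..T}|lborel. (LINT \<omega>|M. \<bar>\<sigma> s (X s \<omega>) - \<sigma>' s (X s \<omega>)\<bar> powr \<alpha>)) powr (1 / \<alpha>)"

text \<open>
  A family is a set of triples \<open>(E, X, X')\<close>: a pair of processes together with its error variable.
\<close>

type_synonym 'w family = "(real \<times> (real \<Rightarrow> 'w \<Rightarrow> real) \<times> (real \<Rightarrow> 'w \<Rightarrow> real)) set"

definition initial_family ::
    "(real \<Rightarrow> 'w \<Rightarrow> real) \<Rightarrow> (real \<Rightarrow> 'w \<Rightarrow> real) \<Rightarrow> 'w family" where
  "initial_family W Z =
     {(\<bar>x0 - x0'\<bar>, \<lambda>t \<omega>. x0 + W t \<omega> + Z t \<omega>, \<lambda>t \<omega>. x0' + W t \<omega> + Z t \<omega>) | x0 x0'. True}"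

definition drift_family :: "'w measure \<Rightarrow> real \<Rightarrow> 'w family" where
  "drift_family M T =
     {(drift_dist M T (\<lambda>_ _. b) (\<lambda>_ _. b') (\<lambda>t \<omega>. b * t), \<lambda>t \<omega>. b * t, \<lambda>t \<omega>. b' * t) | b b'. True}"

definition brownian_family :: "'w measure \<Rightarrow> real \<Rightarrow> (real \<Rightarrow> 'w \<Rightarrow> real) \<Rightarrow> 'w family" where
  "brownian_family M T W =
     {(brownian_dist M T (\<lambda>_ _. a) (\<lambda>_ _. a') (\<lambda>t \<omega>. a * W t \<omega>),
       \<lambda>t \<omega>. a * W t \<omega>, \<lambda>t \<omega>. a' * W t \<omega>) | a a'. True}"

definition stable_family ::
    "'w measure \<Rightarrow> real \<Rightarrow> real \<Rightarrow> (real \<Rightarrow> 'w \<Rightarrow> real) \<Rightarrow> 'w family" where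
  "stable_family M T \<alpha> Z =
     {(stable_dist M T \<alpha> (\<lambda>_ _. \<sigma>) (\<lambda>_ _. \<sigma>') (\<lambda>t \<omega>. \<sigma> * Z t \<omega>),
       \<lambda>t \<omega>. \<sigma> * Z t \<omega>, \<lambda>t \<omega>. \<sigma>' * Z t \<omega>) | \<sigma> \<sigma>'. True}"

text \<open>
  The expectation is taken in \<open>[0, \<infinity>]\<close>: the Bochner integral would assign the value 0 to a
  non-integrable function.
\<close>

definition sup_moment ::
    "'w measure \<Rightarrow> real \<Rightarrow> real \<Rightarrow> (real \<Rightarrow> 'w \<Rightarrow> real) \<Rightarrow> (real \<Rightarrow> 'w \<Rightarrow> real) \<Rightarrow> ennreal" where
  "sup_moment M T p X X' = (SUP t\<in>{0..T}. \<integral>\<^sup>+\<omega>. ennreal (\<bar>X t \<omega> - X' t \<omega>\<bar> powr p) \<partial>M)"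

definition error_bound ::
    "'w measure \<Rightarrow> real \<Rightarrow> real \<Rightarrow> 'w family \<Rightarrow> real \<Rightarrow> real \<Rightarrow> real \<Rightarrow> bool" where
  "error_bound M T p F C q E0 \<longleftrightarrow>
     (\<forall>(E, X, X')\<in>F. 0 < E \<and> E < E0 \<longrightarrow> sup_moment M T p X X' \<le> ennreal (C * E powr q))"

definition optimal_exponent ::
    "'w measure \<Rightarrow> real \<Rightarrow> real \<Rightarrow> 'w family \<Rightarrow> real \<Rightarrow> bool" where
  "optimal_exponent M T p F r \<longleftrightarrow>
     (\<exists>C>0. \<exists>E0>0. error_bound M T p F C r E0) \<and>
     \<not> (\<exists>C>0. \<exists>q>r. \<exists>E0>0. error_bound M T p F C q E0)"

end

theory Submission
  imports Defs
begin

text \<open>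
  In each family the difference of the two processes is a real multiple of one fixed process:
  \<open>X t - X' t = r * Y t\<close>, where \<open>Y\<close> is \<open>1\<close>, \<open>t\<close>, \<open>W\<close> or \<open>Z\<close> respectively, and the error
  variable is \<open>l * \<bar>r\<bar>\<close> with a constant \<open>l > 0\<close>. Hence the supremum of the \<open>p\<close>-th moments equals
  \<open>K * E powr p\<close> where \<open>K\<close> is \<open>l powr (- p)\<close> times the supremum of the \<open>p\<close>-th absolute
  moments of \<open>Y t\<close> over \<open>t\<in>{0..T}\<close>. If \<open>0 < K < \<infinity>\<close>, this is a bound of order
  \<open>p\<close>, and a bound of order \<open>q > p\<close> would force \<open>K \<le> C * E powr (q - p)\<close> for all small \<open>E\<close>, which
  fails as \<open>E\<close> tends to 0 (\<open>optimal_exponent_multiples\<close>).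

  What remains is that \<open>K\<close> is positive and finite. This is trivial for \<open>1\<close> and \<open>t\<close>, and for \<open>W\<close>
  it follows from the second moment. For the stable process, the identity
  \<open>\<bar>x\<bar> powr p * I = \<integral> (1 - cos (u * x)) * \<bar>u\<bar> powr (- 1 - p) du\<close> turns the \<open>p\<close>-th moment into an
  integral of \<open>1 - Re \<phi>\<close>, where \<open>\<phi>\<close> is the characteristic function; near \<open>u = 0\<close> it suffices to
  know \<open>1 - Re \<phi> u \<le> B * \<bar>u\<bar>\<close>, because \<open>p = \<alpha> - 1 < 1\<close>. This follows from a linear bound on the
  Levy exponent, which holds because the Levy measure integrates \<open>min (z\<^sup>2) \<bar>z\<bar>\<close> for
  \<open>1 < \<alpha> < 2\<close>; near 0 the exponent is even of the smaller order \<open>\<bar>u\<bar> powr \<alpha>\<close>, but the linear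
  order already makes the moment finite (\<open>stable_moment_finite\<close>). Positivity holds because the
  real part of the exponent is negative at \<open>u = 1\<close>, so that \<open>\<phi>\<close> is not constantly 1
  (\<open>stable_moment_pos\<close>).
\<close>

section \<open>Homogeneous families\<close>

lemma optimal_exponent_homogeneous:
  assumes "0 < K"
    and sup: "\<And>E X X'. (E, X, X') \<in> F \<Longrightarrow> 0 < E \<Longrightarrow> sup_moment M T p X X' = ennreal (K * E powr p)"
    and ex: "\<And>E. 0 < E \<Longrightarrow> \<exists>X X'. (E, X, X') \<in> F"
  shows "optimal_exponent M T p F p"
  unfolding optimal_exponent_def
proof (intro conjI)
  show "\<exists>C>0. \<exists>E0>0. error_bound M T p F C p E0"
    using assms(1) sup by (intro exI[of _ K] exI[of _ 1] conjI) (auto simp: error_bound_def)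
  show "\<not> (\<exists>C>0. \<exists>q>p. \<exists>E0>0. error_bound M T p F C q E0)"
  proof
    assume "\<exists>C>0. \<exists>q>p. \<exists>E0>0. error_bound M T p F C q E0"
    then obtain C q E0 where *: "C > 0" "q > p" "E0 > 0" "error_bound M T p F C q E0" by blast
    have le: "K \<le> C * E powr (q - p)" if E: "0 < E" "E < E0" for E
    proof -
      obtain X X' where F: "(E, X, X') \<in> F" using ex[OF E(1)] by blast
      have "ennreal (K * E powr p) \<le> ennreal (C * E powr q)"
        using *(4) F E unfolding error_bound_def by (auto simp: sup[OF F E(1), symmetric])
      then have "K * E powr p \<le> C * E powr q"
        using *(1) by (subst (asm) ennreal_le_iff) auto
      also have "\<dots> = C * E powr (q - p) * E powr p"
        using E by (simp add: powr_add[symmetric])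
      finally show ?thesis using E by simp
    qed
    have "((\<lambda>E. C * E powr (q - p)) \<longlongrightarrow> C * 0 powr (q - p)) (at_right 0)"
      using *(2) by (intro tendsto_intros tendsto_powr')
        (auto simp: eventually_at_filter intro!: always_eventually)
    moreover have "\<forall>\<^sub>F E in at_right 0. K \<le> C * E powr (q - p)"
      using eventually_at_right_less[of 0] eventually_at_right_field[of "\<lambda>E. E < E0" 0] *(3) le
      by (auto simp: eventually_at_right_field)
    ultimately have "K \<le> C * 0 powr (q - p)"
      by (intro tendsto_lowerbound) auto
    then show False using assms(1) by simp
  qed
qed

text \<open>
  The factor \<open>\<bar>r\<bar> powr p\<close> leaves the expectation and the supremum, so that each moment is a fixed
  multiple of \<open>E powr p\<close>. The last assumption provides arbitrarily small errors.
\<close>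

lemma optimal_exponent_multiples:
  assumes "0 < l"
    and [measurable]: "\<And>t. t \<in> {0..T} \<Longrightarrow> Y t \<in> borel_measurable M"
    and pos: "0 < (SUP t\<in>{0..T}. \<integral>\<^sup>+\<omega>. ennreal (\<bar>Y t \<omega>\<bar> powr p) \<partial>M)"
    and fin: "(SUP t\<in>{0..T}. \<integral>\<^sup>+\<omega>. ennreal (\<bar>Y t \<omega>\<bar> powr p) \<partial>M) < \<infinity>"
    and F: "\<And>E X X'. (E, X, X') \<in> F \<Longrightarrow>
        \<exists>r. E = l * \<bar>r\<bar> \<and> (\<forall>t \<omega>. X t \<omega> - X' t \<omega> = r * Y t \<omega>)"
    and ex: "\<And>r. \<exists>X X'. (l * \<bar>r\<bar>, X, X') \<in> F"
  shows "optimal_exponent M T p F p"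
proof -
  define k where "k = (SUP t\<in>{0..T}. \<integral>\<^sup>+\<omega>. ennreal (\<bar>Y t \<omega>\<bar> powr p) \<partial>M)"
  define K where "K = enn2real k"
  have k: "k = ennreal K" using fin by (simp add: K_def k_def)
  have "0 < K" using pos fin by (simp add: K_def k_def enn2real_positive_iff)
  show ?thesis
  proof (rule optimal_exponent_homogeneous)
    show "0 < K * (1 / l) powr p" using \<open>0 < K\<close> assms(1) by simp
    show "\<exists>X X'. (E, X, X') \<in> F" if "0 < E" for E
      using ex[of "E / l"] that assms(1) by simp
    fix E X X' assume EF: "(E, X, X') \<in> F" and "0 < E"
    obtain r where r: "E = l * \<bar>r\<bar>" and d: "\<And>t \<omega>. X t \<omega> - X' t \<omega> = r * Y t \<omega>"
      using F[OF EF] by blast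
    have "sup_moment M T p X X'
        = (SUP t\<in>{0..T}. \<integral>\<^sup>+\<omega>. ennreal (\<bar>r\<bar> powr p) * ennreal (\<bar>Y t \<omega>\<bar> powr p) \<partial>M)"
      unfolding sup_moment_def
      by (simp add: d abs_mult powr_mult ennreal_mult)
    also have "\<dots> = (SUP t\<in>{0..T}. ennreal (\<bar>r\<bar> powr p) * (\<integral>\<^sup>+\<omega>. ennreal (\<bar>Y t \<omega>\<bar> powr p) \<partial>M))"
      by (intro SUP_cong refl nn_integral_cmult) measurable
    also have "\<dots> = ennreal (\<bar>r\<bar> powr p) * k"
      unfolding k_def by (rule SUP_mult_left_ennreal[symmetric])
    also have "\<dots> = ennreal (K * \<bar>r\<bar> powr p)"
      using \<open>0 < K\<close> by (simp add: k ennreal_mult' mult.commute)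
    also have "\<bar>r\<bar> powr p = (1 / l) powr p * E powr p"
      using assms(1) by (simp add: r powr_mult[symmetric])
    finally show "sup_moment M T p X X' = ennreal (K * (1 / l) powr p * E powr p)"
      by (simp add: mult.assoc)
  qed
qed

section \<open>Moments from characteristic functions\<close>

lemma nn_integral_powr_split_finite:
  fixes a b :: real
  assumes "-1 < a" "b < -1"
  shows "(\<integral>\<^sup>+z. ennreal (if \<bar>z\<bar> \<le> 1 then \<bar>z\<bar> powr a else \<bar>z\<bar> powr b) \<partial>lborel) < \<infinity>"
proof -
  define g :: "real \<Rightarrow> ennreal" where
    "g z = ennreal (z powr a) * indicator {0..1} z + ennreal (z powr b) * indicator {1..} z" for z
  have [measurable]: "g \<in> borel_measurable borel" unfolding g_def by measurable
  have g: "integral\<^sup>N lborel g < \<infinity>"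
  proof -
    have "integral\<^sup>N lborel g = (\<integral>\<^sup>+z. ennreal (z powr a) * indicator {0..1} z \<partial>lborel)
        + (\<integral>\<^sup>+z. ennreal (z powr b) * indicator {1..} z \<partial>lborel)"
      unfolding g_def by (rule nn_integral_add) measurable
    also have "\<dots> < \<infinity>"
      using nn_integral_has_integral_lebesgue'[OF _ has_integral_powr_from_0[OF assms(1), of 1]]
        nn_integral_has_integral_lebesgue'[OF _ has_integral_powr_to_inf[OF assms(2), of 1]]
      by simp
    finally show ?thesis .
  qed
  have refl: "(\<integral>\<^sup>+z. g (- z) \<partial>lborel) = integral\<^sup>N lborel g"
    using nn_integral_real_affine[of g "-1" 0] by simp
  have "(\<integral>\<^sup>+z. ennreal (if \<bar>z\<bar> \<le> 1 then \<bar>z\<bar> powr a else \<bar>z\<bar> powr b) \<partial>lborel)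
      \<le> (\<integral>\<^sup>+z. g z + g (- z) \<partial>lborel)"
    by (intro nn_integral_mono) (auto simp: g_def indicator_def abs_if)
  also have "\<dots> = integral\<^sup>N lborel g + (\<integral>\<^sup>+z. g (- z) \<partial>lborel)"
    by (rule nn_integral_add) measurable
  also have "\<dots> < \<infinity>" using g refl by simp
  finally show ?thesis .
qed

text \<open>The substitution \<open>v = x * u\<close> extracts the power of \<open>x\<close>.\<close>

lemma nn_integral_one_minus_cos_scale:
  fixes x p :: real
  shows "(\<integral>\<^sup>+u. ennreal ((1 - cos (u * x)) * \<bar>u\<bar> powr (- 1 - p)) \<partial>lborel)
    = ennreal (\<bar>x\<bar> powr p) * (\<integral>\<^sup>+v. ennreal ((1 - cos v) * \<bar>v\<bar> powr (- 1 - p)) \<partial>lborel)"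
    (is "?L = _ * ?I")
proof (cases "x = 0")
  case False
  have "?I = \<bar>x\<bar> * (\<integral>\<^sup>+u. ennreal ((1 - cos (x * u)) * \<bar>x * u\<bar> powr (- 1 - p)) \<partial>lborel)"
    using nn_integral_real_affine[of "\<lambda>v. ennreal ((1 - cos v) * \<bar>v\<bar> powr (- 1 - p))" x 0] False
    by simp
  also have "\<dots> = \<bar>x\<bar> * (\<integral>\<^sup>+u. ennreal (\<bar>x\<bar> powr (- 1 - p)) *
      ennreal ((1 - cos (u * x)) * \<bar>u\<bar> powr (- 1 - p)) \<partial>lborel)"
    by (intro arg_cong2[where f="(*)"] nn_integral_cong refl)
       (simp add: abs_mult powr_mult ennreal_mult[symmetric] mult_ac)
  also have "\<dots> = ennreal \<bar>x\<bar> * (ennreal (\<bar>x\<bar> powr (- 1 - p)) * ?L)"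
    by (subst nn_integral_cmult) auto
  also have "\<dots> = ennreal (\<bar>x\<bar> powr (- p)) * ?L"
    using False by (simp add: mult.assoc[symmetric] ennreal_mult[symmetric] powr_mult_base)
  finally have "ennreal (\<bar>x\<bar> powr p) * ?I = ennreal (\<bar>x\<bar> powr p * \<bar>x\<bar> powr (- p)) * ?L"
    by (simp add: ennreal_mult mult.assoc)
  also have "\<bar>x\<bar> powr p * \<bar>x\<bar> powr (- p) = 1"
    using False by (simp add: powr_add[symmetric])
  finally show ?thesis by simp
qed simp

lemma nn_integral_one_minus_cos_pos:
  fixes p :: real
  shows "0 < (\<integral>\<^sup>+v. ennreal ((1 - cos v) * \<bar>v\<bar> powr (- 1 - p)) \<partial>lborel)"
proof (rule ccontr)
  assume "\<not> ?thesis"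
  then have "(\<integral>\<^sup>+v. ennreal ((1 - cos v) * \<bar>v\<bar> powr (- 1 - p)) \<partial>lborel) = 0" by simp
  then have "AE v in lborel. ennreal ((1 - cos v) * \<bar>v\<bar> powr (- 1 - p)) = 0"
    by (subst (asm) nn_integral_0_iff_AE) auto
  then have "AE v in lborel. v \<notin> {0<..<1::real}"
  proof (rule AE_mp, intro AE_I2 impI notI)
    fix v :: real assume v: "ennreal ((1 - cos v) * \<bar>v\<bar> powr (- 1 - p)) = 0" "v \<in> {0<..<1}"
    have "cos v < cos 0" using v(2) pi_gt3 by (intro cos_monotone_0_pi) auto
    then have "(1 - cos v) * \<bar>v\<bar> powr (- 1 - p) > 0" using v(2) by simp
    then show False using v(1) by (simp only: ennreal_eq_0_iff not_le[symmetric])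
  qed
  then have "emeasure lborel {0<..<1::real} = 0"
    by (subst (asm) AE_iff_measurable[where N="{0<..<1}"]) auto
  then show False by simp
qed

lemma (in real_distribution) one_minus_Re_char:
  "ennreal (1 - Re (char M u)) = (\<integral>\<^sup>+x. ennreal (1 - cos (u * x)) \<partial>M)"
proof -
  have int: "integrable M (\<lambda>x. cos (u * x))"
    by (rule integrable_const_bound[where B=1]) auto
  have "Re (char M u) = (\<integral>x. cos (u * x) \<partial>M)"
    unfolding char_def by (subst integral_Re[symmetric]) (auto intro!: integrable_iexp simp: Re_exp)
  then have "1 - Re (char M u) = (\<integral>x. 1 - cos (u * x) \<partial>M)"
    using int prob_space by simp
  also have "ennreal \<dots> = (\<integral>\<^sup>+x. ennreal (1 - cos (u * x)) \<partial>M)"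
    using int by (intro nn_integral_eq_integral[symmetric]) auto
  finally show ?thesis .
qed

text \<open>
  Integrating \<open>nn_integral_one_minus_cos_scale\<close> over \<open>x\<close> and exchanging the integrals. All
  integrands are nonnegative, so the identity also holds when the moment is infinite and can be
  used to prove that it is finite.
\<close>

lemma (in real_distribution) nn_integral_abs_powr_char:
  "(\<integral>\<^sup>+x. ennreal (\<bar>x\<bar> powr p) \<partial>M) * (\<integral>\<^sup>+v. ennreal ((1 - cos v) * \<bar>v\<bar> powr (- 1 - p)) \<partial>lborel)
    = (\<integral>\<^sup>+u. ennreal ((1 - Re (char M u)) * \<bar>u\<bar> powr (- 1 - p)) \<partial>lborel)"
    (is "_ * ?I = _")
proof -
  interpret P: pair_sigma_finite M lborel ..
  have "(\<integral>\<^sup>+x. ennreal (\<bar>x\<bar> powr p) \<partial>M) * ?I = (\<integral>\<^sup>+x. ennreal (\<bar>x\<bar> powr p) * ?I \<partial>M)"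
    by (rule nn_integral_multc[symmetric]) measurable
  also have "\<dots> = (\<integral>\<^sup>+x. \<integral>\<^sup>+u. ennreal ((1 - cos (u * x)) * \<bar>u\<bar> powr (- 1 - p)) \<partial>lborel \<partial>M)"
    by (simp add: nn_integral_one_minus_cos_scale)
  also have "\<dots> = (\<integral>\<^sup>+u. \<integral>\<^sup>+x. ennreal ((1 - cos (u * x)) * \<bar>u\<bar> powr (- 1 - p)) \<partial>M \<partial>lborel)"
    by (rule P.Fubini'[symmetric]) measurable
  also have "\<dots> = (\<integral>\<^sup>+u. ennreal (1 - Re (char M u)) * ennreal (\<bar>u\<bar> powr (- 1 - p)) \<partial>lborel)"
    by (simp add: one_minus_Re_char ennreal_mult nn_integral_multc)
  also have "\<dots> = (\<integral>\<^sup>+u. ennreal ((1 - Re (char M u)) * \<bar>u\<bar> powr (- 1 - p)) \<partial>lborel)"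
    by (simp add: ennreal_mult'')
  finally show ?thesis .
qed

text \<open>
  In \<open>nn_integral_abs_powr_char\<close>, the linear bound reduces the singularity at \<open>u = 0\<close> to
  \<open>\<bar>u\<bar> powr (- p)\<close>, which is integrable for \<open>p < 1\<close>, and at infinity \<open>1 - Re (char \<mu> u) \<le> 2\<close>
  leaves \<open>\<bar>u\<bar> powr (- 1 - p)\<close>, which is integrable for \<open>0 < p\<close>.
  The constant \<open>k\<close> is chosen before the distribution, because the bound is needed uniformly over
  the marginals of a process.
\<close>

lemma nn_integral_abs_powr_bounded_of_char:
  fixes p B :: real
  assumes "0 < p" "p < 1"
  obtains k where "k < \<infinity>"
    and "\<And>\<mu>. real_distribution \<mu> \<Longrightarrow> (\<And>u. \<bar>u\<bar> \<le> 1 \<Longrightarrow> 1 - Re (char \<mu> u) \<le> B * \<bar>u\<bar>) \<Longrightarrow>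
      (\<integral>\<^sup>+x. ennreal (\<bar>x\<bar> powr p) \<partial>\<mu>) \<le> k"
proof
  define I where "I = (\<integral>\<^sup>+v. ennreal ((1 - cos v) * \<bar>v\<bar> powr (- 1 - p)) \<partial>lborel)"
  define J where
    "J = (\<integral>\<^sup>+u. ennreal (if \<bar>u\<bar> \<le> 1 then \<bar>u\<bar> powr (- p) else \<bar>u\<bar> powr (- 1 - p)) \<partial>lborel)"
  have J: "J < \<infinity>" unfolding J_def by (rule nn_integral_powr_split_finite) (use assms in auto)
  have I: "0 < I" unfolding I_def by (rule nn_integral_one_minus_cos_pos)
  show "ennreal (max 2 B) * J / I < \<infinity>"
    using I J by (auto simp: less_top[symmetric] ennreal_divide_eq_top_iff ennreal_mult_eq_top_iff)
  fix \<mu> :: "real measure"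
  assume "real_distribution \<mu>" and B: "\<And>u. \<bar>u\<bar> \<le> 1 \<Longrightarrow> 1 - Re (char \<mu> u) \<le> B * \<bar>u\<bar>"
  interpret real_distribution \<mu> by fact
  have le: "(1 - Re (char \<mu> u)) * \<bar>u\<bar> powr (- 1 - p)
      \<le> max 2 B * (if \<bar>u\<bar> \<le> 1 then \<bar>u\<bar> powr (- p) else \<bar>u\<bar> powr (- 1 - p))" for u
  proof (cases "\<bar>u\<bar> \<le> 1")
    case True
    have "(1 - Re (char \<mu> u)) * \<bar>u\<bar> powr (- 1 - p) \<le> (max 2 B * \<bar>u\<bar>) * \<bar>u\<bar> powr (- 1 - p)"
      using B[OF True] mult_right_mono[of B "max 2 B" "\<bar>u\<bar>"]
      by (intro mult_right_mono powr_ge_zero) linarith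
    also have "\<dots> = max 2 B * \<bar>u\<bar> powr (- p)"
      by (cases "u = 0") (simp_all add: powr_mult_base mult.assoc)
    finally show ?thesis using True by simp
  next
    case False
    have "- Re (char \<mu> u) \<le> 1"
      using abs_Re_le_cmod[of "char \<mu> u"] cmod_char_le_1[of u] by linarith
    then have "(1 - Re (char \<mu> u)) * \<bar>u\<bar> powr (- 1 - p) \<le> max 2 B * \<bar>u\<bar> powr (- 1 - p)"
      by (intro mult_right_mono) auto
    then show ?thesis using False by simp
  qed
  have "(\<integral>\<^sup>+x. ennreal (\<bar>x\<bar> powr p) \<partial>\<mu>) * I
      \<le> (\<integral>\<^sup>+u. ennreal (max 2 B * (if \<bar>u\<bar> \<le> 1 then \<bar>u\<bar> powr (- p) else \<bar>u\<bar> powr (- 1 - p))) \<partial>lborel)"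
    unfolding I_def nn_integral_abs_powr_char by (intro nn_integral_mono ennreal_leI le)
  also have "\<dots> = ennreal (max 2 B) * J"
    unfolding J_def by (subst nn_integral_cmult[symmetric]) (auto simp: ennreal_mult[symmetric])
  finally have *: "(\<integral>\<^sup>+x. ennreal (\<bar>x\<bar> powr p) \<partial>\<mu>) * I \<le> ennreal (max 2 B) * J" (is "?m * I \<le> ?b") .
  have "?b < \<infinity>" using J by (simp add: ennreal_mult_less_top)
  show "?m \<le> ?b / I"
  proof (cases "I = \<infinity>")
    \<comment> \<open>Then \<open>?b / I\<close> is 0, and a finite product with \<open>I\<close> indeed forces the moment to vanish.\<close>
    case True
    then have "?m = 0" using * \<open>?b < \<infinity>\<close> by (cases "?m = 0") (auto simp: ennreal_mult_top top_unique)
    then show ?thesis by simp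
  next
    case False
    then have "?m = ?m * I / I" using I by (simp add: ennreal_mult_divide_eq)
    also have "\<dots> \<le> ?b / I" using * by (rule divide_right_mono_ennreal)
    finally show ?thesis .
  qed
qed

section \<open>The Levy exponent of the stable process\<close>

text \<open>
  Splits \<open>1 - exp x * cos y\<close> as \<open>(1 - exp x) + exp x * (1 - cos y)\<close>; for \<open>x \<le> 0\<close> the bound is
  linear in \<open>w\<close> without a factor \<open>exp (cmod w)\<close>.
\<close>

lemma one_minus_Re_exp_le:
  fixes w :: complex
  assumes "Re w \<le> 0"
  shows "1 - Re (exp w) \<le> 2 * cmod w"
proof -
  have "1 - cos (Im w) \<le> cmod (iexp (Im w) - 1)"
    using abs_Re_le_cmod[of "iexp (Im w) - 1"] by (simp add: Re_exp)
  also have "\<dots> \<le> \<bar>Im w\<bar>" using iexp_approx1[of "Im w" 0] by simp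
  finally have c: "1 - cos (Im w) \<le> cmod w" using abs_Im_le_cmod[of w] by linarith
  have e: "1 - exp (Re w) \<le> cmod w"
    using exp_ge_add_one_self[of "Re w"] abs_Re_le_cmod[of w] by linarith
  have "exp (Re w) * (1 - cos (Im w)) \<le> 1 * (1 - cos (Im w))"
    using assms by (intro mult_right_mono) auto
  then show ?thesis using c e by (simp add: Re_exp algebra_simps)
qed

lemma sets_stable_levy_measure [measurable_cong]: "sets (stable_levy_measure \<alpha> c) = sets borel"
  by (simp add: stable_levy_measure_def)

lemma integrable_stable_levy_measure:
  assumes "1 < \<alpha>" "\<alpha> < 2" "0 < c"
  shows "integrable (stable_levy_measure \<alpha> c) (\<lambda>z. min (z\<^sup>2) \<bar>z\<bar>)"
proof (rule integrableI_nonneg)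
  define f where "f z = (if \<bar>z\<bar> \<le> 1 then \<bar>z\<bar> powr (1 - \<alpha>) else \<bar>z\<bar> powr (- \<alpha>))" for z :: real
  have [measurable]: "f \<in> borel_measurable borel" unfolding f_def by measurable
  have le: "c * \<bar>z\<bar> powr (- 1 - \<alpha>) * min (z\<^sup>2) \<bar>z\<bar> = c * f z" for z :: real
  proof (cases "z = 0")
    case False
    have "\<bar>z\<bar> * \<bar>z\<bar> powr (- 1 - \<alpha>) = \<bar>z\<bar> powr (- \<alpha>)" "\<bar>z\<bar> * \<bar>z\<bar> powr (- \<alpha>) = \<bar>z\<bar> powr (1 - \<alpha>)"
      by (simp_all add: powr_mult_base)
    moreover have "z\<^sup>2 = \<bar>z\<bar> * \<bar>z\<bar>" by (simp add: power2_eq_square)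
    moreover have "\<bar>z\<bar> * \<bar>z\<bar> \<le> \<bar>z\<bar> \<longleftrightarrow> \<bar>z\<bar> \<le> 1"
      using False mult_le_cancel_left_pos[of "\<bar>z\<bar>" "\<bar>z\<bar>" 1] by simp
    ultimately have "\<bar>z\<bar> powr (- 1 - \<alpha>) * min (z\<^sup>2) \<bar>z\<bar> = f z"
      by (cases "\<bar>z\<bar> \<le> 1") (simp_all only: f_def min_def if_True if_False mult_ac)
    then show ?thesis by (simp add: mult.assoc)
  qed (simp add: f_def)
  have "(\<integral>\<^sup>+z. ennreal (min (z\<^sup>2) \<bar>z\<bar>) \<partial>stable_levy_measure \<alpha> c) = (\<integral>\<^sup>+z. ennreal c * ennreal (f z) \<partial>lborel)"
    unfolding stable_levy_measure_def using assms(3)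
    by (subst nn_integral_density) (auto simp: ennreal_mult'[symmetric] ennreal_mult''[symmetric] le)
  also have "\<dots> = ennreal c * (\<integral>\<^sup>+z. ennreal (f z) \<partial>lborel)"
    by (rule nn_integral_cmult) measurable
  also have "\<dots> < \<infinity>"
    using nn_integral_powr_split_finite[of "1 - \<alpha>" "- \<alpha>"] assms
    by (simp add: f_def ennreal_mult_less_top)
  finally show "(\<integral>\<^sup>+z. ennreal (min (z\<^sup>2) \<bar>z\<bar>) \<partial>stable_levy_measure \<alpha> c) < \<infinity>" .
qed auto

text \<open>
  Small jumps are compensated, so the second-order Taylor bound \<open>(u * z)\<^sup>2 / 2\<close> applies, and one
  factor \<open>\<bar>u\<bar>\<close> of it is given away; large jumps only have the first-order bound.
\<close>

lemma cmod_levy_integrand_le: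
  fixes u z :: real
  assumes "\<bar>u\<bar> \<le> 1"
  shows "cmod (iexp (u * z) - 1 - \<i> * of_real (u * z * indicator {-1..1} z)) \<le> \<bar>u\<bar> * min (z\<^sup>2) \<bar>z\<bar>"
proof (cases "\<bar>z\<bar> \<le> 1")
  case True
  then have [simp]: "indicator {-1..1} z = (1 :: real)" by (simp add: indicator_def abs_le_iff)
  have "cmod (iexp (u * z) - 1 - \<i> * of_real (u * z * indicator {-1..1} z)) \<le> \<bar>u * z\<bar>\<^sup>2 / 2"
    using iexp_approx1[of "u * z" 1] by (simp add: numeral_2_eq_2 algebra_simps)
  also have "\<dots> \<le> \<bar>u\<bar> * z\<^sup>2"
  proof -
    have "\<bar>u * z\<bar>\<^sup>2 = \<bar>u\<bar> * (\<bar>u\<bar> * z\<^sup>2)" by (simp add: power_mult_distrib power2_eq_square)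
    also have "\<dots> \<le> \<bar>u\<bar> * (1 * z\<^sup>2)" using assms by (intro mult_left_mono mult_right_mono) auto
    finally show ?thesis using zero_le_power2[of "\<bar>u * z\<bar>"] by linarith
  qed
  also have "z\<^sup>2 = min (z\<^sup>2) \<bar>z\<bar>"
    using True mult_left_mono[OF True, of "\<bar>z\<bar>"] by (simp add: min_def power2_eq_square)
  finally show ?thesis .
next
  case False
  then have [simp]: "indicator {-1..1} z = (0 :: real)" by (auto simp: indicator_def)
  have "cmod (iexp (u * z) - 1 - \<i> * of_real (u * z * indicator {-1..1} z)) \<le> \<bar>u\<bar> * \<bar>z\<bar>"
    using iexp_approx1[of "u * z" 0] by (simp add: abs_mult)
  moreover have "min (z\<^sup>2) \<bar>z\<bar> = \<bar>z\<bar>"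
    using False mult_left_mono[of 1 "\<bar>z\<bar>" "\<bar>z\<bar>"] by (simp add: min_def power2_eq_square)
  ultimately show ?thesis by simp
qed

lemma integrable_levy_integrand:
  assumes "1 < \<alpha>" "\<alpha> < 2" "0 < c" "\<bar>u\<bar> \<le> 1"
  shows "integrable (stable_levy_measure \<alpha> c)
    (\<lambda>z. iexp (u * z) - 1 - \<i> * of_real (u * z * indicator {-1..1} z))"
proof (rule Bochner_Integration.integrable_bound)
  show "integrable (stable_levy_measure \<alpha> c) (\<lambda>z. \<bar>u\<bar> * min (z\<^sup>2) \<bar>z\<bar>)"
    using integrable_stable_levy_measure[OF assms(1-3)] by simp
  show "AE z in stable_levy_measure \<alpha> c. cmod (iexp (u * z) - 1 - \<i> * of_real (u * z * indicator {-1..1} z))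
      \<le> norm (\<bar>u\<bar> * min (z\<^sup>2) \<bar>z\<bar>)"
    using cmod_levy_integrand_le[OF assms(4)] by (auto intro: order_trans abs_ge_self)
qed measurable

lemma Re_levy_exponent_stable:
  assumes "1 < \<alpha>" "\<alpha> < 2" "0 < c" "\<bar>u\<bar> \<le> 1"
  shows "integrable (stable_levy_measure \<alpha> c) (\<lambda>z. 1 - cos (u * z))"
    and "Re (levy_exponent 0 0 (stable_levy_measure \<alpha> c) u)
      = - (\<integral>z. 1 - cos (u * z) \<partial>stable_levy_measure \<alpha> c)"
proof -
  note int = integrable_levy_integrand[OF assms]
  have Re: "Re (iexp (u * z) - 1 - \<i> * of_real (u * z * indicator {-1..1} z)) = - (1 - cos (u * z))"
    for z by (simp add: Re_exp)
  show "integrable (stable_levy_measure \<alpha> c) (\<lambda>z. 1 - cos (u * z))"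
    using integrable_minus[OF integrable_Re[OF int]] unfolding Re by simp
  show "Re (levy_exponent 0 0 (stable_levy_measure \<alpha> c) u)
      = - (\<integral>z. 1 - cos (u * z) \<partial>stable_levy_measure \<alpha> c)"
    using integral_Re[OF int] unfolding Re levy_exponent_def Bochner_Integration.integral_minus by simp
qed

lemma cmod_levy_exponent_stable_le:
  assumes "1 < \<alpha>" "\<alpha> < 2" "0 < c" "\<bar>u\<bar> \<le> 1"
  shows "cmod (levy_exponent 0 0 (stable_levy_measure \<alpha> c) u)
    \<le> \<bar>u\<bar> * (\<integral>z. min (z\<^sup>2) \<bar>z\<bar> \<partial>stable_levy_measure \<alpha> c)"
proof -
  have "cmod (levy_exponent 0 0 (stable_levy_measure \<alpha> c) u)
    \<le> (\<integral>z. \<bar>u\<bar> * min (z\<^sup>2) \<bar>z\<bar> \<partial>stable_levy_measure \<alpha> c)"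
    unfolding levy_exponent_def
    using Bochner_Integration.integral_norm_bound_integral[OF integrable_levy_integrand[OF assms]
        integrable_mult_right[OF integrable_stable_levy_measure[OF assms(1-3)]], of "\<bar>u\<bar>"]
      cmod_levy_integrand_le[OF assms(4)] by simp
  then show ?thesis by simp
qed

text \<open>
  The real part at 1 is \<open>- (\<integral>z. 1 - cos z \<partial>\<nu>)\<close>, whose integrand is positive almost everywhere with
  respect to a measure with a positive density.
\<close>

lemma Re_levy_exponent_stable_neg:
  assumes "1 < \<alpha>" "\<alpha> < 2" "0 < c"
  shows "Re (levy_exponent 0 0 (stable_levy_measure \<alpha> c) 1) < 0"
proof -
  let ?\<nu> = "stable_levy_measure \<alpha> c"
  note Re = Re_levy_exponent_stable[OF assms, of 1, simplified]
  have "(\<integral>z. 1 - cos z \<partial>?\<nu>) \<noteq> 0"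
  proof
    assume "(\<integral>z. 1 - cos z \<partial>?\<nu>) = 0"
    then have "AE z in ?\<nu>. 1 - cos z = 0"
      using Re(1) by (subst (asm) integral_nonneg_eq_0_iff_AE) auto
    then have "AE z in lborel. 0 < ennreal (c * \<bar>z\<bar> powr (- 1 - \<alpha>)) \<longrightarrow> 1 - cos z = 0"
      unfolding stable_levy_measure_def by (subst (asm) AE_density) auto
    \<comment> \<open>This weight turns the statement into a vanishing cosine integral with exponent \<open>p = 0\<close>.\<close>
    then have "AE z in lborel. ennreal ((1 - cos z) * \<bar>z\<bar> powr (- 1 - 0)) = 0"
      by (rule AE_mp) (use assms(3) in \<open>auto intro!: AE_I2\<close>)
    then have "(\<integral>\<^sup>+z. ennreal ((1 - cos z) * \<bar>z\<bar> powr (- 1 - 0)) \<partial>lborel) = 0"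
      by (subst nn_integral_0_iff_AE) auto
    then show False using nn_integral_one_minus_cos_pos[of 0] by simp
  qed
  moreover have "0 \<le> (\<integral>z. 1 - cos z \<partial>?\<nu>)" by (intro integral_nonneg_AE) auto
  ultimately show ?thesis using Re(2) by linarith
qed

section \<open>Moments of the driving processes\<close>

lemma nn_integral_abs_powr_eq_0:
  assumes "X \<in> borel_measurable M" "(\<integral>\<^sup>+\<omega>. ennreal (\<bar>X \<omega>\<bar> powr p) \<partial>M) = 0"
  shows "AE \<omega> in M. X \<omega> = (0 :: real)"
  using assms by (subst (asm) nn_integral_0_iff_AE) (auto simp: ennreal_eq_0_iff)

text \<open>
  A vanishing moment would make \<open>Z T\<close> almost surely zero, with characteristic function 1; but the
  exponent has a negative real part at 1.
\<close>

lemma stable_moment_pos: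
  assumes "prob_space M" "1 < \<alpha>" "\<alpha> < 2" "0 < T" "0 < c" "symmetric_stable_process M T \<alpha> c Z"
  shows "0 < (\<integral>\<^sup>+\<omega>. ennreal (\<bar>Z T \<omega>\<bar> powr p) \<partial>M)"
proof (rule ccontr)
  interpret prob_space M by fact
  let ?\<psi> = "levy_exponent 0 0 (stable_levy_measure \<alpha> c)"
  have [measurable]: "Z T \<in> borel_measurable M"
    and char: "char (distr M borel (Z T)) 1 = exp (of_real T * ?\<psi> 1)"
    using assms(4,6) by (auto simp: symmetric_stable_process_def levy_process_def)
  assume "\<not> ?thesis"
  then have "AE \<omega> in M. Z T \<omega> = 0"
    by (intro nn_integral_abs_powr_eq_0) auto
  then have "(CLINT \<omega>|M. iexp (1 * Z T \<omega>)) = (CLINT \<omega>|M. 1)"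
    by (intro integral_cong_AE) auto
  then have "char (distr M borel (Z T)) 1 = (CLINT \<omega>|M. 1)"
    unfolding char_def by (subst integral_distr) auto
  also have "\<dots> = 1" by (simp add: prob_space)
  finally have "cmod (exp (of_real T * ?\<psi> 1)) = 1" using char by simp
  then have "Re (of_real T * ?\<psi> 1) = 0" by (simp add: norm_exp_eq_Re)
  then show False
    using assms(4) Re_levy_exponent_stable_neg[OF assms(2,3,5)] by simp
qed

lemma stable_moment_finite:
  assumes "prob_space M" "1 < \<alpha>" "\<alpha> < 2" "0 < T" "0 < c" "symmetric_stable_process M T \<alpha> c Z"
    and p: "0 < p" "p < 1"
  shows "(SUP t\<in>{0..T}. \<integral>\<^sup>+\<omega>. ennreal (\<bar>Z t \<omega>\<bar> powr p) \<partial>M) < \<infinity>"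
proof -
  interpret prob_space M by fact
  let ?\<nu> = "stable_levy_measure \<alpha> c"
  let ?\<psi> = "levy_exponent 0 0 ?\<nu>"
  define B where "B = 2 * T * (\<integral>z. min (z\<^sup>2) \<bar>z\<bar> \<partial>?\<nu>)"
  obtain k where k: "k < \<infinity>"
    "\<And>\<mu>. real_distribution \<mu> \<Longrightarrow> (\<And>u. \<bar>u\<bar> \<le> 1 \<Longrightarrow> 1 - Re (char \<mu> u) \<le> B * \<bar>u\<bar>) \<Longrightarrow>
      (\<integral>\<^sup>+x. ennreal (\<bar>x\<bar> powr p) \<partial>\<mu>) \<le> k"
    using nn_integral_abs_powr_bounded_of_char[OF p, of B] by blast
  have "(\<integral>\<^sup>+\<omega>. ennreal (\<bar>Z t \<omega>\<bar> powr p) \<partial>M) \<le> k" if t: "t \<in> {0..T}" for t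
  proof -
    have [measurable]: "Z t \<in> borel_measurable M"
      and char: "\<And>u. char (distr M borel (Z t)) u = exp (of_real t * ?\<psi> u)"
      using t assms(6) by (auto simp: symmetric_stable_process_def levy_process_def)
    have "(\<integral>\<^sup>+x. ennreal (\<bar>x\<bar> powr p) \<partial>distr M borel (Z t)) \<le> k"
    proof (rule k(2))
      show "real_distribution (distr M borel (Z t))" by simp
      fix u :: real assume u: "\<bar>u\<bar> \<le> 1"
      have "Re (?\<psi> u) \<le> 0"
        unfolding Re_levy_exponent_stable(2)[OF assms(2,3,5) u] by (simp add: integral_nonneg_AE)
      then have "1 - Re (exp (of_real t * ?\<psi> u)) \<le> 2 * cmod (of_real t * ?\<psi> u)"
        using t by (intro one_minus_Re_exp_le) (auto simp: mult_nonneg_nonpos)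
      also have "\<dots> = 2 * t * cmod (?\<psi> u)" using t by (simp add: norm_mult)
      also have "\<dots> \<le> 2 * T * (\<bar>u\<bar> * (\<integral>z. min (z\<^sup>2) \<bar>z\<bar> \<partial>?\<nu>))"
        using t by (intro mult_mono cmod_levy_exponent_stable_le assms u) auto
      finally show "1 - Re (char (distr M borel (Z t)) u) \<le> B * \<bar>u\<bar>"
        by (simp add: char B_def mult_ac)
    qed
    then show ?thesis by (subst (asm) nn_integral_distr) auto
  qed
  then have "(SUP t\<in>{0..T}. \<integral>\<^sup>+\<omega>. ennreal (\<bar>Z t \<omega>\<bar> powr p) \<partial>M) \<le> k" by (intro SUP_least)
  then show ?thesis using k(1) by (rule le_less_trans)
qed

lemma brownian_second_moment:
  assumes "prob_space M" "standard_brownian_motion M T W" "t \<in> {0..T}"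
  shows "(\<integral>\<^sup>+\<omega>. ennreal ((W t \<omega>)\<^sup>2) \<partial>M) = ennreal t"
proof -
  interpret prob_space M by fact
  have W0: "AE \<omega> in M. W 0 \<omega> = 0" using assms(2) by (simp add: standard_brownian_motion_def)
  show ?thesis
  proof (cases "t = 0")
    case True
    have "(\<integral>\<^sup>+\<omega>. ennreal ((W t \<omega>)\<^sup>2) \<partial>M) = (\<integral>\<^sup>+\<omega>. 0 \<partial>M)"
      using W0 by (intro nn_integral_cong_AE) (auto simp: True)
    then show ?thesis using True by simp
  next
    case False
    then have t: "0 < sqrt t" using assms(3) by simp
    have D: "distributed M lborel (\<lambda>\<omega>. W t \<omega> - W 0 \<omega>) (normal_density 0 (sqrt t))"
    proof -
      have "\<forall>s t. 0 \<le> s \<and> s < t \<and> t \<le> T \<longrightarrow>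
          distributed M lborel (\<lambda>\<omega>. W t \<omega> - W s \<omega>) (normal_density 0 (sqrt (t - s)))"
        using assms(2) by (simp add: standard_brownian_motion_def)
      from this[rule_format, of 0 t] show ?thesis using assms(3) False by simp
    qed
    have "(\<integral>\<^sup>+\<omega>. ennreal ((W t \<omega>)\<^sup>2) \<partial>M) = (\<integral>\<^sup>+\<omega>. ennreal ((W t \<omega> - W 0 \<omega>)\<^sup>2) \<partial>M)"
      using W0 by (intro nn_integral_cong_AE) auto
    also have "\<dots> = (\<integral>\<^sup>+x. ennreal (normal_density 0 (sqrt t) x) * ennreal (x\<^sup>2) \<partial>lborel)"
      by (rule distributed_nn_integral[OF D, symmetric]) measurable
    also have "\<dots> = (\<integral>\<^sup>+x. ennreal (normal_density 0 (sqrt t) x * (x - 0) ^ (2 * 1)) \<partial>lborel)"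
      by (simp add: ennreal_mult)
    also have "\<dots> = ennreal (fact (2 * 1) / ((2 / (sqrt t)\<^sup>2) ^ 1 * fact 1))"
      by (intro nn_integral_eq_integral[THEN trans] integrable_normal_moment[OF t] AE_I2
          arg_cong[where f=ennreal] has_bochner_integral_integral_eq[OF normal_moment_even[OF t]])
        simp
    also have "\<dots> = ennreal t" using t by simp
    finally show ?thesis .
  qed
qed

lemma brownian_moment_pos:
  assumes "prob_space M" "0 < T" "standard_brownian_motion M T W"
  shows "0 < (\<integral>\<^sup>+\<omega>. ennreal (\<bar>W T \<omega>\<bar> powr p) \<partial>M)"
proof (rule ccontr)
  have [measurable]: "W T \<in> borel_measurable M"
    using assms(2,3) by (auto simp: standard_brownian_motion_def)
  assume "\<not> ?thesis"
  then have "AE \<omega> in M. W T \<omega> = 0"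
    by (intro nn_integral_abs_powr_eq_0) auto
  then have "(\<integral>\<^sup>+\<omega>. ennreal ((W T \<omega>)\<^sup>2) \<partial>M) = (\<integral>\<^sup>+\<omega>. 0 \<partial>M)"
    by (intro nn_integral_cong_AE) auto
  then show False using brownian_second_moment[OF assms(1,3), of T] assms(2) by simp
qed

lemma brownian_moment_finite:
  assumes "prob_space M" "standard_brownian_motion M T W" and p: "0 \<le> p" "p \<le> 2"
  shows "(SUP t\<in>{0..T}. \<integral>\<^sup>+\<omega>. ennreal (\<bar>W t \<omega>\<bar> powr p) \<partial>M) < \<infinity>"
proof -
  interpret prob_space M by fact
  have le: "\<bar>x\<bar> powr p \<le> 1 + x\<^sup>2" for x :: real
  proof (cases "\<bar>x\<bar> \<le> 1")
    case True
    then have "\<bar>x\<bar> powr p \<le> 1" using p by (intro powr_le1) auto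
    then show ?thesis by (simp add: add_increasing2)
  next
    case False
    then have "\<bar>x\<bar> powr p \<le> \<bar>x\<bar> powr 2" using p by (intro powr_mono) auto
    then show ?thesis using False by (simp add: powr_numeral)
  qed
  have "(\<integral>\<^sup>+\<omega>. ennreal (\<bar>W t \<omega>\<bar> powr p) \<partial>M) \<le> 1 + ennreal T" if t: "t \<in> {0..T}" for t
  proof -
    have [measurable]: "W t \<in> borel_measurable M"
      using t assms(2) by (auto simp: standard_brownian_motion_def)
    have "(\<integral>\<^sup>+\<omega>. ennreal (\<bar>W t \<omega>\<bar> powr p) \<partial>M) \<le> (\<integral>\<^sup>+\<omega>. 1 + ennreal ((W t \<omega>)\<^sup>2) \<partial>M)"
      using le by (intro nn_integral_mono) (simp flip: ennreal_1 ennreal_plus)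
    also have "\<dots> = 1 + ennreal t"
      by (subst nn_integral_add) (auto simp: emeasure_space_1 brownian_second_moment[OF assms(1,2) t])
    also have "\<dots> \<le> 1 + ennreal T" using t by (intro add_left_mono ennreal_leI) auto
    finally show ?thesis .
  qed
  then have "(SUP t\<in>{0..T}. \<integral>\<^sup>+\<omega>. ennreal (\<bar>W t \<omega>\<bar> powr p) \<partial>M) \<le> 1 + ennreal T"
    by (intro SUP_least)
  also have "\<dots> < \<infinity>" by simp
  finally show ?thesis .
qed

section \<open>The four families\<close>

lemma drift_dist_const:
  assumes "prob_space M" "0 < T"
  shows "drift_dist M T (\<lambda>_ _. b) (\<lambda>_ _. b') X = T * \<bar>b - b'\<bar>"
  using assms by (simp add: drift_dist_def prob_space.prob_space set_lebesgue_integral_def)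

lemma brownian_dist_const:
  assumes "prob_space M" "0 < T"
  shows "brownian_dist M T (\<lambda>_ _. a) (\<lambda>_ _. a') X = T powr (1 / 2) * \<bar>a - a'\<bar>"
  using assms
  by (simp add: brownian_dist_def prob_space.prob_space set_lebesgue_integral_def powr_half_sqrt
      real_sqrt_mult)

lemma stable_dist_const:
  assumes "prob_space M" "0 < T" "\<alpha> \<noteq> 0"
  shows "stable_dist M T \<alpha> (\<lambda>_ _. s) (\<lambda>_ _. s') X = T powr (1 / \<alpha>) * \<bar>s - s'\<bar>"
  using assms
  by (simp add: stable_dist_def prob_space.prob_space set_lebesgue_integral_def powr_mult powr_powr)

lemma optimal_exponent_families:
  fixes T \<alpha> c p :: real
  assumes M: "prob_space M"
    and \<alpha>: "1 < \<alpha>" "\<alpha> < 2" and T: "0 < T" and c: "0 < c" and p: "0 < p" "p < 1"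
    and W: "standard_brownian_motion M T W"
    and Z: "symmetric_stable_process M T \<alpha> c Z"
  shows "optimal_exponent M T p (initial_family W Z) p"
    and "optimal_exponent M T p (drift_family M T) p"
    and "optimal_exponent M T p (brownian_family M T W) p"
    and "optimal_exponent M T p (stable_family M T \<alpha> Z) p"
proof -
  interpret prob_space M by (rule M)
  have pos: "0 < (SUP t\<in>{0..T}. f t)" if "0 < f T" for f :: "real \<Rightarrow> ennreal"
    using that T by (intro less_le_trans[OF that] SUP_upper) auto
  show "optimal_exponent M T p (initial_family W Z) p"
  proof (rule optimal_exponent_multiples[where l=1 and Y="\<lambda>_ _. 1"])
    show "\<exists>X X'. (1 * \<bar>r\<bar>, X, X') \<in> initial_family W Z" for r
    proof -
      have "(\<bar>r - 0\<bar>, \<lambda>t \<omega>. r + W t \<omega> + Z t \<omega>, \<lambda>t \<omega>. 0 + W t \<omega> + Z t \<omega>) \<in> initial_family W Z"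
        unfolding initial_family_def by blast
      then show ?thesis by auto
    qed
  qed (use T in \<open>auto simp: initial_family_def emeasure_space_1\<close>)
  show "optimal_exponent M T p (drift_family M T) p"
  proof (rule optimal_exponent_multiples[where l=T and Y="\<lambda>t _. t"])
    have "(SUP t\<in>{0..T}. \<integral>\<^sup>+\<omega>. ennreal (\<bar>t\<bar> powr p) \<partial>M) \<le> ennreal (T powr p)"
      using p by (intro SUP_least) (auto simp: emeasure_space_1 intro!: ennreal_leI powr_mono2)
    also have "\<dots> < \<infinity>" by simp
    finally show "(SUP t\<in>{0..T}. \<integral>\<^sup>+\<omega>. ennreal (\<bar>t\<bar> powr p) \<partial>M) < \<infinity>" .
    show "0 < (SUP t\<in>{0..T}. \<integral>\<^sup>+\<omega>. ennreal (\<bar>t\<bar> powr p) \<partial>M)"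
      by (rule pos) (use T in \<open>simp add: emeasure_space_1\<close>)
    show "\<exists>X X'. (T * \<bar>r\<bar>, X, X') \<in> drift_family M T" for r
    proof -
      have "(T * \<bar>r - 0\<bar>, \<lambda>t \<omega>. r * t, \<lambda>t \<omega>. 0 * t) \<in> drift_family M T"
        unfolding drift_family_def drift_dist_const[OF M T] by blast
      then show ?thesis by auto
    qed
  qed (use T in \<open>auto simp: drift_family_def drift_dist_const[OF M T] algebra_simps\<close>)
  show "optimal_exponent M T p (brownian_family M T W) p"
  proof (rule optimal_exponent_multiples[where l="T powr (1 / 2)" and Y=W])
    show "W t \<in> borel_measurable M" if "t \<in> {0..T}" for t
      using W that by (simp add: standard_brownian_motion_def)
    show "0 < (SUP t\<in>{0..T}. \<integral>\<^sup>+\<omega>. ennreal (\<bar>W t \<omega>\<bar> powr p) \<partial>M)"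
      by (rule pos) (rule brownian_moment_pos[OF M T W])
    show "(SUP t\<in>{0..T}. \<integral>\<^sup>+\<omega>. ennreal (\<bar>W t \<omega>\<bar> powr p) \<partial>M) < \<infinity>"
      using p by (intro brownian_moment_finite[OF M W]) auto
    show "\<exists>X X'. (T powr (1 / 2) * \<bar>r\<bar>, X, X') \<in> brownian_family M T W" for r
    proof -
      have "(T powr (1 / 2) * \<bar>r - 0\<bar>, \<lambda>t \<omega>. r * W t \<omega>, \<lambda>t \<omega>. 0 * W t \<omega>) \<in> brownian_family M T W"
        unfolding brownian_family_def brownian_dist_const[OF M T] by blast
      then show ?thesis by auto
    qed
  qed (use T in \<open>auto simp: brownian_family_def brownian_dist_const[OF M T] algebra_simps\<close>)
  have "\<alpha> \<noteq> 0" using \<alpha> by simp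
  note dist = stable_dist_const[OF M T this]
  show "optimal_exponent M T p (stable_family M T \<alpha> Z) p"
  proof (rule optimal_exponent_multiples[where l="T powr (1 / \<alpha>)" and Y=Z])
    show "Z t \<in> borel_measurable M" if "t \<in> {0..T}" for t
      using Z that by (simp add: symmetric_stable_process_def levy_process_def)
    show "0 < (SUP t\<in>{0..T}. \<integral>\<^sup>+\<omega>. ennreal (\<bar>Z t \<omega>\<bar> powr p) \<partial>M)"
      by (rule pos) (rule stable_moment_pos[OF M \<alpha> T c Z])
    show "(SUP t\<in>{0..T}. \<integral>\<^sup>+\<omega>. ennreal (\<bar>Z t \<omega>\<bar> powr p) \<partial>M) < \<infinity>"
      by (rule stable_moment_finite[OF M \<alpha> T c Z p])
    show "\<exists>X X'. (T powr (1 / \<alpha>) * \<bar>r\<bar>, X, X') \<in> stable_family M T \<alpha> Z" for r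
    proof -
      have "(T powr (1 / \<alpha>) * \<bar>r - 0\<bar>, \<lambda>t \<omega>. r * Z t \<omega>, \<lambda>t \<omega>. 0 * Z t \<omega>) \<in> stable_family M T \<alpha> Z"
        unfolding stable_family_def dist by blast
      then show ?thesis by auto
    qed
  qed (use T in \<open>auto simp: stable_family_def dist algebra_simps\<close>)
qed

theorem proposition5p2:
  fixes M :: "'w measure"
    and W Z :: "real \<Rightarrow> 'w \<Rightarrow> real"
    and \<alpha> c p T :: real
  assumes "prob_space M"
    and "1 < \<alpha>" and "\<alpha> < 2" and "p = \<alpha> - 1" and "0 < T" and "0 < c"
    and "standard_brownian_motion M T W"
    and "symmetric_stable_process M T \<alpha> c Z"
    and "indep_processes M T W Z"
  shows
    "(\<forall>b b'. drift_dist M T (\<lambda>_ _. b) (\<lambda>_ _. b') (\<lambda>t \<omega>. b * t) = T * \<bar>b - b'\<bar>) \<and>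
     (\<forall>a a'. brownian_dist M T (\<lambda>_ _. a) (\<lambda>_ _. a') (\<lambda>t \<omega>. a * W t \<omega>)
               = T powr (1 / 2) * \<bar>a - a'\<bar>) \<and>
     (\<forall>\<sigma> \<sigma>'. stable_dist M T \<alpha> (\<lambda>_ _. \<sigma>) (\<lambda>_ _. \<sigma>') (\<lambda>t \<omega>. \<sigma> * Z t \<omega>)
               = T powr (1 / \<alpha>) * \<bar>\<sigma> - \<sigma>'\<bar>) \<and>
     (\<forall>F \<in> {initial_family W Z, drift_family M T, brownian_family M T W, stable_family M T \<alpha> Z}.
        \<not> (\<exists>C>0. \<exists>q>p. \<exists>E0>0. \<forall>(E, X, X')\<in>F. 0 < E \<and> E < E0 \<longrightarrow>
              (SUP t\<in>{0..T}. \<integral>\<^sup>+\<omega>. ennreal (\<bar>X t \<omega> - X' t \<omega>\<bar> powr p) \<partial>M)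
                \<le> ennreal (C * E powr q))) \<and>
     (\<forall>F \<in> {initial_family W Z, drift_family M T, brownian_family M T W, stable_family M T \<alpha> Z}.
        optimal_exponent M T p F (\<alpha> - 1))"
proof -
  have p: "0 < \<alpha> - 1" "\<alpha> - 1 < 1" "\<alpha> \<noteq> 0" using assms(2,3) by auto
  have opt: "\<forall>F \<in> {initial_family W Z, drift_family M T, brownian_family M T W, stable_family M T \<alpha> Z}.
      optimal_exponent M T p F (\<alpha> - 1)"
    using optimal_exponent_families[OF assms(1-3,5,6) p(1,2) assms(7,8)] assms(4) by simp
  moreover have "\<forall>F \<in> {initial_family W Z, drift_family M T, brownian_family M T W, stable_family M T \<alpha> Z}.
        \<not> (\<exists>C>0. \<exists>q>p. \<exists>E0>0. \<forall>(E, X, X')\<in>F. 0 < E \<and> E < E0 \<longrightarrow>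
              (SUP t\<in>{0..T}. \<integral>\<^sup>+\<omega>. ennreal (\<bar>X t \<omega> - X' t \<omega>\<bar> powr p) \<partial>M)
                \<le> ennreal (C * E powr q))"
    using opt unfolding optimal_exponent_def error_bound_def sup_moment_def assms(4) by blast
  ultimately show ?thesis
    using drift_dist_const[OF assms(1,5)] brownian_dist_const[OF assms(1,5)]
      stable_dist_const[OF assms(1,5) p(3)] by blast
qed

end
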